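(* For $\rho\in\widehat{G}$, the $H$-module $\overline{V}(\rho)$ is an $x$- and $y$-torsion simple $H$-module.
   Context: $\mathbb{K}$ is an algebraically closed field of characteristic zero, $G$ is a finitely generated abelian group, $\widehat{G}$ is the group of homomorphisms $G\to\mathbb{K}^\times$, $\chi\in\widehat{G}$ has finite order $n$, and $b,c\in G$ satisfy $\chi(b)=\chi(c)$ and $bc\neq1$. Put $e=c^{-1}-b\in\mathbb{K}[G]$. $H=H(G,\chi,\chi^{-1},b,c,1)$ is (after replacing its second Ore variable $y$ by $c^{-1}y$) the algebra generated by $G,x,y$ subject to the relations of $G$ and $xg=\chi(g)gx$, $yg=\chi(g)^{-1}gy$ $(g\in G)$, $yx=xy+e$; it has $\mathbb{K}$-basis $\{gx^iy^j\mid g\in G,\ i,j\ge 0\}$. Let $\sigma:\mathbb{K}[G]\to\mathbb{K}[G]$ be the automorphism with $\sigma(g)=\chi(g)g$, and for $u\in\mathbb{K}[G]$ let $[u]_i^\sigma=\sum_{k=0}^{i-1}\sigma^{-k}(u)$ for $i\ge1$, $[u]_0^\sigma=0$. Characters $\rho\in\widehat{G}$ are extended to algebra maps $\rho:\mathbb{K}[G]\to\mathbb{K}$. $V(\rho)$ is the $H$-module with basis $\{v_i\mid i\ge0\}$ and action $x\cdot v_i=v_{i+1}$, $g\cdot v_i=\rho(\sigma^{-i}(g))v_i$ for $g\in G$, $y\cdot v_0=0$, $y\cdot v_i=\rho([e]_i^\sigma)v_{i-1}$ for $i\ge1$. Since $\chi$ has order $n$, $[e]_n^\sigma=0$. Let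 $d$ be the least positive integer such that $\rho([e]_d^\sigma)=0$, and set $\overline{V}(\rho)=V(\rho)/Hv_d$, a $d$-dimensional module with basis the images of $v_0,\ldots,v_{d-1}$. A module is $x$-torsion if each of its elements is killed by some power $x^k$, $k\ge1$; similarly for $y$. *)

theory Defs
  imports
    "HOL-Library.Poly_Mapping"
    "HOL-Computational_Algebra.Polynomial"
    "HOL-Algebra.Algebraic_Closure_Type"
    "HOL-Algebra.QuotRing"
    "HOL-Algebra.Module"
    "HOL-Algebra.Generated_Groups"
    "HOL-Algebra.Multiplicative_Group"
begin

section \<open>The abelian group and its characters\<close>

text \<open>
  The abelian group is a type of class \<^class>\<open>ab_group_add\<close>, so it is written additively:
  the product of \<open>b\<close> and \<open>c\<close> is \<open>b + c\<close>, the inverse of \<open>c\<close> is \<open>- c\<close> and the identity is \<open>0\<close>.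
  The group algebra over \<open>'k\<close> is then the type \<open>'g \<Rightarrow>\<^sub>0 'k\<close> with its convolution product, the
  group element \<open>g\<close> being \<open>Poly_Mapping.single g 1\<close>.
\<close>

definition group_of_type :: "'g::ab_group_add monoid" where
  "group_of_type = \<lparr>carrier = UNIV, monoid.mult = (+), one = 0\<rparr>"

definition finitely_generated :: "('a, 'b) monoid_scheme \<Rightarrow> bool" where
  "finitely_generated G \<longleftrightarrow> (\<exists>S. finite S \<and> S \<subseteq> carrier G \<and> generate G S = carrier G)"

definition characters :: "('g::ab_group_add \<Rightarrow> 'k::field) monoid" where
  "characters =
     \<lparr>carrier = hom group_of_type (mult_of ring_of_type_algebra),
      monoid.mult = (\<lambda>\<phi> \<psi> g. \<phi> g * \<psi> g), one = (\<lambda>_. 1)\<rparr>"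

definition char_ext :: "('g \<Rightarrow> 'k) \<Rightarrow> ('g \<Rightarrow>\<^sub>0 'k) \<Rightarrow> 'k::field" where
  "char_ext \<rho> u = (\<Sum>g\<in>Poly_Mapping.keys u. Poly_Mapping.lookup u g * \<rho> g)"

definition sigma :: "('g \<Rightarrow> 'k) \<Rightarrow> ('g \<Rightarrow>\<^sub>0 'k) \<Rightarrow> ('g \<Rightarrow>\<^sub>0 'k::field)" where
  "sigma \<chi> u = Poly_Mapping.mapp (\<lambda>g k. \<chi> g * k) u"

definition sigma_bracket :: "('g \<Rightarrow> 'k) \<Rightarrow> ('g \<Rightarrow>\<^sub>0 'k) \<Rightarrow> nat \<Rightarrow> ('g \<Rightarrow>\<^sub>0 'k::field)" where
  "sigma_bracket \<chi> u i = (\<Sum>k<i. (inv_into UNIV (sigma \<chi>) ^^ k) u)"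

definition e_elt :: "'g \<Rightarrow> 'g \<Rightarrow> ('g::ab_group_add \<Rightarrow>\<^sub>0 'k::field)" where
  "e_elt b c = Poly_Mapping.single (- c) 1 - Poly_Mapping.single b 1"


section \<open>The algebra by generators and relations\<close>

datatype 'a free_monoid = Word (letters: "'a list")

instantiation free_monoid :: (type) monoid_add
begin

definition "0 = Word []"
definition "v + w = Word (letters v @ letters w)"

instance
  by standard (simp_all add: zero_free_monoid_def plus_free_monoid_def)

end

datatype 'g gen = Gr 'g | GenX | GenY

text \<open>
  The free algebra is the monoid algebra of the free monoid, and the ground field acts through
  the multiples of \<open>1\<close>.
\<close>

type_synonym ('g, 'k) free_alg = "'g gen free_monoid \<Rightarrow>\<^sub>0 'k"

definition scal :: "'k::field \<Rightarrow> ('g, 'k) free_alg" where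
  "scal k = Poly_Mapping.single 0 k"

definition gen_elt :: "'g gen \<Rightarrow> ('g, 'k::field) free_alg" where
  "gen_elt a = Poly_Mapping.single (Word [a]) 1"

abbreviation gr :: "'g \<Rightarrow> ('g, 'k::field) free_alg" where
  "gr g \<equiv> gen_elt (Gr g)"

abbreviation xx :: "('g, 'k::field) free_alg" where
  "xx \<equiv> gen_elt GenX"

abbreviation yy :: "('g, 'k::field) free_alg" where
  "yy \<equiv> gen_elt GenY"

definition relators ::
    "('g \<Rightarrow> 'k) \<Rightarrow> 'g \<Rightarrow> 'g \<Rightarrow> ('g::ab_group_add, 'k::field) free_alg set" where
  "relators \<chi> b c =
     {gr 0 - 1}
     \<union> {gr g * gr h - gr (g + h) | g h. True}
     \<union> {xx * gr g - scal (\<chi> g) * gr g * xx | g. True}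
     \<union> {yy * gr g - scal (inverse (\<chi> g)) * gr g * yy | g. True}
     \<union> {yy * xx - (xx * yy + (gr (- c) - gr b))}"

definition free_ring :: "('g, 'k::field) free_alg ring" where
  "free_ring = ring_of_type_algebra"

definition rel_ideal ::
    "('g \<Rightarrow> 'k) \<Rightarrow> 'g \<Rightarrow> 'g \<Rightarrow> ('g::ab_group_add, 'k::field) free_alg set" where
  "rel_ideal \<chi> b c = Idl\<^bsub>free_ring\<^esub> (relators \<chi> b c)"

definition H_alg ::
    "('g \<Rightarrow> 'k) \<Rightarrow> 'g \<Rightarrow> 'g \<Rightarrow> ('g::ab_group_add, 'k::field) free_alg set ring" where
  "H_alg \<chi> b c = free_ring Quot (rel_ideal \<chi> b c)"

definition H_class ::
    "('g \<Rightarrow> 'k) \<Rightarrow> 'g \<Rightarrow> 'g \<Rightarrow> ('g, 'k) free_alg \<Rightarrow> ('g::ab_group_add, 'k::field) free_alg set"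
  where "H_class \<chi> b c f = rel_ideal \<chi> b c +>\<^bsub>free_ring\<^esub> f"


section \<open>Left modules over a not necessarily commutative ring\<close>

text \<open>
  The library locale \<^locale>\<open>module\<close> requires a commutative ring; the axioms are repeated here for
  an arbitrary one.  The fields \<open>mult\<close> and \<open>one\<close> of a module record carry no meaning.
\<close>

locale left_module = R?: ring R + M?: abelian_group M
  for R :: "'a ring" (structure) and M :: "('a, 'm) module" (structure) +
  assumes smult_closed:
      "\<lbrakk>a \<in> carrier R; u \<in> carrier M\<rbrakk> \<Longrightarrow> a \<odot>\<^bsub>M\<^esub> u \<in> carrier M"
    and smult_l_distr:
      "\<lbrakk>a \<in> carrier R; b \<in> carrier R; u \<in> carrier M\<rbrakk> \<Longrightarrow>
        (a \<oplus> b) \<odot>\<^bsub>M\<^esub> u = a \<odot>\<^bsub>M\<^esub> u \<oplus>\<^bsub>M\<^esub> b \<odot>\<^bsub>M\<^esub> u"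
    and smult_r_distr:
      "\<lbrakk>a \<in> carrier R; u \<in> carrier M; v \<in> carrier M\<rbrakk> \<Longrightarrow>
        a \<odot>\<^bsub>M\<^esub> (u \<oplus>\<^bsub>M\<^esub> v) = a \<odot>\<^bsub>M\<^esub> u \<oplus>\<^bsub>M\<^esub> a \<odot>\<^bsub>M\<^esub> v"
    and smult_assoc:
      "\<lbrakk>a \<in> carrier R; b \<in> carrier R; u \<in> carrier M\<rbrakk> \<Longrightarrow>
        (a \<otimes> b) \<odot>\<^bsub>M\<^esub> u = a \<odot>\<^bsub>M\<^esub> (b \<odot>\<^bsub>M\<^esub> u)"
    and smult_one: "u \<in> carrier M \<Longrightarrow> \<one> \<odot>\<^bsub>M\<^esub> u = u"

definition simple_module :: "'a ring \<Rightarrow> ('a, 'm) module \<Rightarrow> bool" where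
  "simple_module R M \<longleftrightarrow>
     left_module R M \<and> carrier M \<noteq> {\<zero>\<^bsub>M\<^esub>} \<and>
     (\<forall>N. submodule N R M \<longrightarrow> N = {\<zero>\<^bsub>M\<^esub>} \<or> N = carrier M)"

definition torsion_module :: "'a ring \<Rightarrow> 'a \<Rightarrow> ('a, 'm) module \<Rightarrow> bool" where
  "torsion_module R r M \<longleftrightarrow>
     (\<forall>u\<in>carrier M. \<exists>k::nat. k \<ge> 1 \<and> (r [^]\<^bsub>R\<^esub> k) \<odot>\<^bsub>M\<^esub> u = \<zero>\<^bsub>M\<^esub>)"

definition cyclic_submodule :: "'a ring \<Rightarrow> ('a, 'm) module \<Rightarrow> 'm \<Rightarrow> 'm set" where
  "cyclic_submodule R M u = {r \<odot>\<^bsub>M\<^esub> u | r. r \<in> carrier R}"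

definition quotient_module :: "('a, 'm) module \<Rightarrow> 'm set \<Rightarrow> ('a, 'm set) module" where
  "quotient_module M N =
     \<lparr>carrier = a_rcosets\<^bsub>M\<^esub> N, monoid.mult = undefined, one = undefined,
      zero = N, add = set_add M,
      module.smult = (\<lambda>r C. \<Union>u\<in>C. N +>\<^bsub>M\<^esub> (r \<odot>\<^bsub>M\<^esub> u))\<rparr>"


section \<open>The modules \<open>V(\<rho>)\<close> and their quotients\<close>

text \<open>
  The space with basis \<open>v\<^sub>0, v\<^sub>1, \<dots>\<close> is \<open>nat \<Rightarrow>\<^sub>0 'k\<close>, with \<open>v\<^sub>i = Poly_Mapping.single i 1\<close>.
\<close>

definition smul :: "'k \<Rightarrow> ('a \<Rightarrow>\<^sub>0 'k) \<Rightarrow> ('a \<Rightarrow>\<^sub>0 'k::field)" where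
  "smul a u = Poly_Mapping.map ((*) a) u"

definition lin_ext :: "('b \<Rightarrow> ('a \<Rightarrow>\<^sub>0 'k)) \<Rightarrow> ('b \<Rightarrow>\<^sub>0 'k) \<Rightarrow> ('a \<Rightarrow>\<^sub>0 'k::field)" where
  "lin_ext B u = (\<Sum>i\<in>Poly_Mapping.keys u. smul (Poly_Mapping.lookup u i) (B i))"

definition vb :: "nat \<Rightarrow> (nat \<Rightarrow>\<^sub>0 'k::field)" where
  "vb i = Poly_Mapping.single i 1"

fun gen_on_basis ::
    "('g::ab_group_add \<Rightarrow> 'k::field) \<Rightarrow> 'g \<Rightarrow> 'g \<Rightarrow> ('g \<Rightarrow> 'k) \<Rightarrow> 'g gen \<Rightarrow> nat
      \<Rightarrow> (nat \<Rightarrow>\<^sub>0 'k)" where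
  "gen_on_basis \<chi> b c \<rho> GenX i = vb (Suc i)"
| "gen_on_basis \<chi> b c \<rho> (Gr g) i =
     smul (char_ext \<rho> ((inv_into UNIV (sigma \<chi>) ^^ i) (Poly_Mapping.single g 1))) (vb i)"
| "gen_on_basis \<chi> b c \<rho> GenY 0 = 0"
| "gen_on_basis \<chi> b c \<rho> GenY (Suc i) =
     smul (char_ext \<rho> (sigma_bracket \<chi> (e_elt b c) (Suc i))) (vb i)"

definition gen_act ::
    "('g::ab_group_add \<Rightarrow> 'k::field) \<Rightarrow> 'g \<Rightarrow> 'g \<Rightarrow> ('g \<Rightarrow> 'k) \<Rightarrow> 'g gen
      \<Rightarrow> (nat \<Rightarrow>\<^sub>0 'k) \<Rightarrow> (nat \<Rightarrow>\<^sub>0 'k)" where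
  "gen_act \<chi> b c \<rho> a u = lin_ext (gen_on_basis \<chi> b c \<rho> a) u"

definition free_act ::
    "('g::ab_group_add \<Rightarrow> 'k::field) \<Rightarrow> 'g \<Rightarrow> 'g \<Rightarrow> ('g \<Rightarrow> 'k) \<Rightarrow> ('g, 'k) free_alg
      \<Rightarrow> (nat \<Rightarrow>\<^sub>0 'k) \<Rightarrow> (nat \<Rightarrow>\<^sub>0 'k)" where
  "free_act \<chi> b c \<rho> f u = lin_ext (\<lambda>w. foldr (gen_act \<chi> b c \<rho>) (letters w) u) f"

text \<open>
  A coset acts as any of its representatives does; when \<open>\<chi>\<close> and \<open>\<rho>\<close> are characters,
  the set whose \<^const>\<open>the_elem\<close> is taken is a singleton.
\<close>

definition V_mod ::
    "('g::ab_group_add \<Rightarrow> 'k::field) \<Rightarrow> 'g \<Rightarrow> 'g \<Rightarrow> ('g \<Rightarrow> 'k)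
      \<Rightarrow> (('g, 'k) free_alg set, nat \<Rightarrow>\<^sub>0 'k) module" where
  "V_mod \<chi> b c \<rho> =
     \<lparr>carrier = UNIV, monoid.mult = undefined, one = undefined, zero = 0, add = (+),
      module.smult = (\<lambda>h u. the_elem ((\<lambda>f. free_act \<chi> b c \<rho> f u) ` h))\<rparr>"

text \<open>
  The index \<open>d\<close> is a parameter, to be the least positive integer with
  \<open>char_ext \<rho> (sigma_bracket \<chi> (e_elt b c) d) = 0\<close>.  Let \<open>\<chi>\<close> have order \<open>n\<close> and \<open>\<chi> b = \<chi> c\<close>.  If
  \<open>\<chi> b \<noteq> 1\<close>, then \<open>sigma_bracket \<chi> (e_elt b c) n = 0\<close>, so \<open>d\<close> exists for every \<open>\<rho>\<close>.  If \<open>\<chi> b = 1\<close>,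
  then \<open>sigma_bracket \<chi> (e_elt b c) i\<close> is \<open>i\<close> times \<open>e_elt b c\<close>, so in characteristic zero \<open>d\<close>
  exists only when \<open>\<rho>\<close> kills \<open>e_elt b c\<close>, and then \<open>d = 1\<close>.
\<close>

definition V_bar ::
    "('g::ab_group_add \<Rightarrow> 'k::field) \<Rightarrow> 'g \<Rightarrow> 'g \<Rightarrow> ('g \<Rightarrow> 'k) \<Rightarrow> nat
      \<Rightarrow> (('g, 'k) free_alg set, (nat \<Rightarrow>\<^sub>0 'k) set) module" where
  "V_bar \<chi> b c \<rho> d =
     quotient_module (V_mod \<chi> b c \<rho>)
       (cyclic_submodule (H_alg \<chi> b c) (V_mod \<chi> b c \<rho>) (vb d))"

end

theory Submission
  imports Defs
begin

text \<open>
  On \<open>V(\<rho>)\<close> the generator \<open>x\<close> raises the index of a basis vector by one, the group elements act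
  diagonally, and \<open>y \<cdot> v\<^sub>i = \<beta>\<^sub>i v\<^sub>i\<^sub>-\<^sub>1\<close> with \<open>\<beta>\<^sub>i = \<rho>([e]\<^sub>i\<^sup>\<sigma>)\<close>. The index \<open>d\<close> is the first positive one
  with \<open>\<beta>\<^sub>d = 0\<close>. Thus \<open>y\<close> cannot lead from \<open>v\<^sub>d\<close> back to \<open>v\<^sub>d\<^sub>-\<^sub>1\<close>, and \<open>H v\<^sub>d\<close> is the span of
  \<open>v\<^sub>d, v\<^sub>d\<^sub>+\<^sub>1, \<dots>\<close> (\<open>cyclic_submodule_eq_tail\<close>). Both torsion claims follow: \<open>x\<^sup>d\<close> pushes every
  vector into this span, and \<open>y\<^sup>d\<close> kills \<open>v\<^sub>0, \<dots>, v\<^sub>d\<^sub>-\<^sub>1\<close> while preserving the span.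

  For simplicity, the span has to be a maximal submodule (\<open>tail_maximal\<close>). A larger submodule
  contains a vector that modulo the span has a leading term \<open>v\<^sub>m\<close> with \<open>m < d\<close>. Since
  \<open>\<beta>\<^sub>1, \<dots>, \<beta>\<^sub>m\<close> are nonzero, \<open>y\<^sup>m\<close> turns it into a nonzero multiple of \<open>v\<^sub>0\<close>, and \<open>v\<^sub>0\<close> generates
  \<open>V(\<rho>)\<close> under \<open>x\<close>.

  Before this, the formulas on generators must be seen to define an \<open>H\<close>-module. The free algebra
  acts on \<open>V(\<rho>)\<close> by construction; the relators act as zero (\<open>act_relators\<close>), the essential case
  \<open>yx = xy + e\<close> being the recursion \<open>\<beta>\<^sub>i\<^sub>+\<^sub>1 = \<beta>\<^sub>i + \<rho>(\<sigma>\<^sup>-\<^sup>i(e))\<close>, so the action descends to the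
  quotient \<open>H\<close>.
\<close>

section \<open>Quotients of left modules\<close>

context left_module
begin

lemma smult_l_zero:
  assumes "u \<in> carrier M"
  shows "\<zero>\<^bsub>R\<^esub> \<odot>\<^bsub>M\<^esub> u = \<zero>\<^bsub>M\<^esub>"
  using assms smult_l_distr[of "\<zero>\<^bsub>R\<^esub>" "\<zero>\<^bsub>R\<^esub>" u] smult_closed[of "\<zero>\<^bsub>R\<^esub>" u]
  by (metis M.add.r_cancel_one' R.l_zero R.zero_closed)

lemma smult_minus_one:
  assumes "u \<in> carrier M"
  shows "(\<ominus>\<^bsub>R\<^esub> \<one>\<^bsub>R\<^esub>) \<odot>\<^bsub>M\<^esub> u = \<ominus>\<^bsub>M\<^esub> u"
proof -
  have "(\<ominus>\<^bsub>R\<^esub> \<one>\<^bsub>R\<^esub>) \<odot>\<^bsub>M\<^esub> u \<oplus>\<^bsub>M\<^esub> \<one>\<^bsub>R\<^esub> \<odot>\<^bsub>M\<^esub> u = \<zero>\<^bsub>M\<^esub>"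
    using assms smult_l_distr[of "\<ominus>\<^bsub>R\<^esub> \<one>\<^bsub>R\<^esub>" "\<one>\<^bsub>R\<^esub>" u] by (simp add: R.l_neg smult_l_zero)
  then show ?thesis
    using assms by (simp add: smult_one smult_closed M.minus_equality)
qed

text \<open>
  Closure under negation comes from the action of \<open>-1\<close>.
\<close>

lemma submoduleI:
  assumes "S \<subseteq> carrier M" and "\<zero>\<^bsub>M\<^esub> \<in> S"
    and "\<And>u v. u \<in> S \<Longrightarrow> v \<in> S \<Longrightarrow> u \<oplus>\<^bsub>M\<^esub> v \<in> S"
    and smult: "\<And>a u. a \<in> carrier R \<Longrightarrow> u \<in> S \<Longrightarrow> a \<odot>\<^bsub>M\<^esub> u \<in> S"
  shows "submodule S R M"
proof (intro submodule.intro subgroup.intro submodule_axioms.intro)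
  show "inv\<^bsub>add_monoid M\<^esub> u \<in> S" if "u \<in> S" for u
    using that assms(1) smult_minus_one[of u] smult[of "\<ominus>\<^bsub>R\<^esub> \<one>\<^bsub>R\<^esub>" u]
    by (auto simp flip: a_inv_def)
qed (use assms in auto)

lemma smult_pow:
  assumes "a \<in> carrier R" "u \<in> carrier M"
  shows "(a [^] (k::nat)) \<odot>\<^bsub>M\<^esub> u = ((\<lambda>v. a \<odot>\<^bsub>M\<^esub> v) ^^ k) u"
  using assms(2)
proof (induction k arbitrary: u)
  case 0
  then show ?case by (simp add: smult_one)
next
  case (Suc k)
  then show ?case
    using assms(1) by (simp add: smult_assoc smult_closed funpow_Suc_right del: funpow.simps)
qed

lemma submodule_abelian_subgroup:
  assumes "submodule N R M"
  shows "abelian_subgroup N M"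
  using assms M.abelian_group_axioms
  by (intro abelian_subgroupI3 additive_subgroupI) (simp_all add: submodule_def)

text \<open>
  The action on a coset is defined as a union over its representatives; stability of \<open>N\<close> makes
  all the cosets in that union equal.
\<close>

lemma quotient_smult:
  assumes N: "submodule N R M" and a: "a \<in> carrier R" and u: "u \<in> carrier M"
  shows "a \<odot>\<^bsub>quotient_module M N\<^esub> (N +>\<^bsub>M\<^esub> u) = N +>\<^bsub>M\<^esub> (a \<odot>\<^bsub>M\<^esub> u)"
proof -
  interpret N: abelian_subgroup N M by (rule submodule_abelian_subgroup[OF N])
  have "N +>\<^bsub>M\<^esub> (a \<odot>\<^bsub>M\<^esub> v) = N +>\<^bsub>M\<^esub> (a \<odot>\<^bsub>M\<^esub> u)" if v: "v \<in> N +>\<^bsub>M\<^esub> u" for v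
  proof -
    from v obtain w where w: "w \<in> N" "v = w \<oplus>\<^bsub>M\<^esub> u"
      by (auto simp: a_r_coset_def')
    then have wM: "w \<in> carrier M" by auto
    have "a \<odot>\<^bsub>M\<^esub> v = a \<odot>\<^bsub>M\<^esub> w \<oplus>\<^bsub>M\<^esub> a \<odot>\<^bsub>M\<^esub> u"
      using w wM a u by (simp add: smult_r_distr)
    moreover have "a \<odot>\<^bsub>M\<^esub> w \<in> N"
      by (rule submodule.smult_closed[OF N a w(1)])
    ultimately have "a \<odot>\<^bsub>M\<^esub> v \<in> N +>\<^bsub>M\<^esub> (a \<odot>\<^bsub>M\<^esub> u)"
      by (auto simp: a_r_coset_def')
    then show ?thesis
      using N.a_repr_independence'[OF _ smult_closed[OF a u]] by simp
  qed
  moreover have "N +>\<^bsub>M\<^esub> u \<noteq> {}" using N.a_rcos_self[OF u] by blast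
  ultimately have "(\<Union>v\<in>N +>\<^bsub>M\<^esub> u. N +>\<^bsub>M\<^esub> (a \<odot>\<^bsub>M\<^esub> v)) = N +>\<^bsub>M\<^esub> (a \<odot>\<^bsub>M\<^esub> u)"
    by (rule SUP_eq_const[rotated])
  then show ?thesis
    by (simp add: quotient_module_def)
qed

lemma quotient_simps:
  assumes "submodule N R M"
  shows "carrier (quotient_module M N) = (\<lambda>u. N +>\<^bsub>M\<^esub> u) ` carrier M"
    and "\<zero>\<^bsub>quotient_module M N\<^esub> = N"
    and "u \<in> carrier M \<Longrightarrow> v \<in> carrier M \<Longrightarrow>
      (N +>\<^bsub>M\<^esub> u) \<oplus>\<^bsub>quotient_module M N\<^esub> (N +>\<^bsub>M\<^esub> v) = N +>\<^bsub>M\<^esub> (u \<oplus>\<^bsub>M\<^esub> v)"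
proof -
  interpret N: abelian_subgroup N M by (rule submodule_abelian_subgroup[OF assms])
  show "carrier (quotient_module M N) = (\<lambda>u. N +>\<^bsub>M\<^esub> u) ` carrier M"
    by (auto simp: quotient_module_def A_RCOSETS_def')
  show "\<zero>\<^bsub>quotient_module M N\<^esub> = N" by (simp add: quotient_module_def)
  show "u \<in> carrier M \<Longrightarrow> v \<in> carrier M \<Longrightarrow>
      (N +>\<^bsub>M\<^esub> u) \<oplus>\<^bsub>quotient_module M N\<^esub> (N +>\<^bsub>M\<^esub> v) = N +>\<^bsub>M\<^esub> (u \<oplus>\<^bsub>M\<^esub> v)"
    by (simp add: quotient_module_def N.a_rcos_sum)
qed

lemma coset_eq_submodule_iff:
  assumes "submodule N R M" "u \<in> carrier M"
  shows "N +>\<^bsub>M\<^esub> u = N \<longleftrightarrow> u \<in> N"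
proof -
  interpret N: abelian_subgroup N M by (rule submodule_abelian_subgroup[OF assms(1)])
  show ?thesis using N.a_rcos_self[OF assms(2)] N.a_rcos_const by auto
qed

lemma quotient_left_module:
  assumes N: "submodule N R M"
  shows "left_module R (quotient_module M N)"
proof -
  interpret N: abelian_subgroup N M by (rule submodule_abelian_subgroup[OF N])
  have coset_zero: "N +>\<^bsub>M\<^esub> \<zero>\<^bsub>M\<^esub> = N" by (simp add: N.a_rcos_const)
  have "abelian_group (quotient_module M N)"
  proof (rule abelian_groupI)
    show "\<zero>\<^bsub>quotient_module M N\<^esub> \<in> carrier (quotient_module M N)"
      using M.zero_closed coset_zero by (force simp: quotient_simps[OF N])
    fix x assume "x \<in> carrier (quotient_module M N)"
    then obtain u where u: "u \<in> carrier M" "x = N +>\<^bsub>M\<^esub> u"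
      by (auto simp: quotient_simps[OF N])
    show "\<zero>\<^bsub>quotient_module M N\<^esub> \<oplus>\<^bsub>quotient_module M N\<^esub> x = x"
      using quotient_simps(3)[OF N M.zero_closed u(1)] u
      by (simp add: quotient_simps(2)[OF N] coset_zero)
    show "\<exists>y\<in>carrier (quotient_module M N).
        y \<oplus>\<^bsub>quotient_module M N\<^esub> x = \<zero>\<^bsub>quotient_module M N\<^esub>"
    proof
      show "N +>\<^bsub>M\<^esub> (\<ominus>\<^bsub>M\<^esub> u) \<in> carrier (quotient_module M N)"
        using u by (auto simp: quotient_simps[OF N])
      show "(N +>\<^bsub>M\<^esub> (\<ominus>\<^bsub>M\<^esub> u)) \<oplus>\<^bsub>quotient_module M N\<^esub> x = \<zero>\<^bsub>quotient_module M N\<^esub>"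
        using u by (simp add: quotient_simps[OF N] M.l_neg coset_zero)
    qed
  qed (auto simp: quotient_simps[OF N] M.a_assoc M.a_comm M.a_lcomm)
  then show ?thesis
    by (intro left_module.intro left_module_axioms.intro R.ring_axioms)
      (auto simp: quotient_simps[OF N] quotient_smult[OF N] smult_closed smult_l_distr
        smult_r_distr smult_assoc smult_one)
qed

text \<open>
  Torsion of the quotient can be checked upstairs, by iterating the action of the single
  element \<open>a\<close> on \<open>M\<close> until it reaches \<open>N\<close>.
\<close>

lemma quotient_torsion:
  assumes N: "submodule N R M" and a: "a \<in> carrier R"
    and "\<And>u. u \<in> carrier M \<Longrightarrow> \<exists>k::nat. k \<ge> 1 \<and> ((\<lambda>v. a \<odot>\<^bsub>M\<^esub> v) ^^ k) u \<in> N"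
  shows "torsion_module R a (quotient_module M N)"
  unfolding torsion_module_def
proof
  fix x assume "x \<in> carrier (quotient_module M N)"
  then obtain u where u: "u \<in> carrier M" "x = N +>\<^bsub>M\<^esub> u"
    by (auto simp: quotient_simps[OF N])
  obtain k :: nat where k: "k \<ge> 1" "(a [^] k) \<odot>\<^bsub>M\<^esub> u \<in> N"
    using assms(3)[OF u(1)] a u by (auto simp: smult_pow)
  then show "\<exists>k::nat. k \<ge> 1 \<and> (a [^] k) \<odot>\<^bsub>quotient_module M N\<^esub> x = \<zero>\<^bsub>quotient_module M N\<^esub>"
    using a u by (auto intro!: exI[of _ k]
        simp: quotient_smult[OF N] quotient_simps[OF N] coset_eq_submodule_iff[OF N] smult_closed)
qed

text \<open>
  Submodules of the quotient correspond to submodules of \<open>M\<close> containing \<open>N\<close>, so a maximal proper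
  submodule has a simple quotient.
\<close>

lemma quotient_simple:
  assumes N: "submodule N R M" and "N \<noteq> carrier M"
    and max: "\<And>L. submodule L R M \<Longrightarrow> N \<subseteq> L \<Longrightarrow> L = N \<or> L = carrier M"
  shows "simple_module R (quotient_module M N)"
proof -
  interpret N: abelian_subgroup N M by (rule submodule_abelian_subgroup[OF N])
  interpret Q: left_module R "quotient_module M N" by (rule quotient_left_module[OF N])
  note Q = quotient_simps[OF N]
  obtain u where u: "u \<in> carrier M" "u \<notin> N"
    using assms(2) N.a_subset by auto
  have "N +>\<^bsub>M\<^esub> u \<noteq> N" using u coset_eq_submodule_iff[OF N] by simp
  then have nontrivial: "carrier (quotient_module M N) \<noteq> {\<zero>\<^bsub>quotient_module M N\<^esub>}"
    using u by (auto simp: Q)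
  have "P = {\<zero>\<^bsub>quotient_module M N\<^esub>} \<or> P = carrier (quotient_module M N)"
    if P: "submodule P R (quotient_module M N)" for P
  proof -
    interpret P: abelian_subgroup P "quotient_module M N"
      by (rule Q.submodule_abelian_subgroup[OF P])
    \<comment> \<open>the preimage of \<open>P\<close> under the projection\<close>
    define L where "L = {u \<in> carrier M. N +>\<^bsub>M\<^esub> u \<in> P}"
    have P_L: "P = (\<lambda>u. N +>\<^bsub>M\<^esub> u) ` L"
      using P.a_subset by (auto simp: L_def Q)
    have NL: "N \<subseteq> L"
      using P.zero_closed by (auto simp: L_def Q N.a_rcos_const)
    have smult: "a \<odot>\<^bsub>M\<^esub> u \<in> L" if "a \<in> carrier R" "u \<in> L" for a u
      using submodule.smult_closed[OF P, of a "N +>\<^bsub>M\<^esub> u"] that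
      by (auto simp: L_def quotient_smult[OF N] smult_closed)
    have "submodule L R M"
    proof (rule submoduleI)
      show "x \<oplus>\<^bsub>M\<^esub> y \<in> L" if "x \<in> L" "y \<in> L" for x y
        using that P.a_closed[of "N +>\<^bsub>M\<^esub> x" "N +>\<^bsub>M\<^esub> y"] by (simp add: L_def Q(3))
      show "\<zero>\<^bsub>M\<^esub> \<in> L" using NL N.zero_closed by auto
      show "L \<subseteq> carrier M" by (auto simp: L_def)
    qed (rule smult)
    from max[OF this NL] show ?thesis
    proof
      assume "L = N"
      then have "P = (\<lambda>_. N) ` N" using P_L N.a_rcos_const by simp
      then have "P = {N}" by (simp only: image_constant[OF N.zero_closed])
      then show ?thesis by (simp add: Q)
    next
      assume "L = carrier M"
      then show ?thesis using P_L by (simp add: Q)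
    qed
  qed
  then show ?thesis
    using nontrivial Q.left_module_axioms by (simp add: simple_module_def)
qed

end


section \<open>Linear extension of maps between free vector spaces\<close>

lemma lookup_smul [simp]:
  "Poly_Mapping.lookup (smul a u) i = a * Poly_Mapping.lookup u i"
  unfolding smul_def by (cases "Poly_Mapping.lookup u i = 0") (simp_all add: map.rep_eq)

lemma smul_add_right: "smul a (u + v) = smul a u + smul a v"
  and smul_add_left: "smul (a + a') u = smul a u + smul a' u"
  and smul_smul: "smul a (smul a' u) = smul (a * a') u"
  and smul_0_left [simp]: "smul 0 u = 0"
  and smul_0_right [simp]: "smul a 0 = 0"
  and smul_1 [simp]: "smul 1 u = u"
  by (rule poly_mapping_eqI; simp add: lookup_add algebra_simps)+

lemma poly_mapping_sum_single:
  fixes u :: "'a \<Rightarrow>\<^sub>0 'b::comm_monoid_add"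
  shows "u = (\<Sum>i\<in>Poly_Mapping.keys u. Poly_Mapping.single i (Poly_Mapping.lookup u i))"
proof (rule poly_mapping_eqI)
  fix k
  show "Poly_Mapping.lookup u k =
    Poly_Mapping.lookup (\<Sum>i\<in>Poly_Mapping.keys u. Poly_Mapping.single i (Poly_Mapping.lookup u i)) k"
    by (simp add: lookup_sum lookup_single when_def in_keys_iff)
qed

lemma poly_mapping_single_induct [case_names zero single add]:
  fixes u :: "'a \<Rightarrow>\<^sub>0 'b::comm_monoid_add"
  assumes "P 0" and "\<And>i a. P (Poly_Mapping.single i a)"
    and "\<And>u v. P u \<Longrightarrow> P v \<Longrightarrow> P (u + v)"
  shows "P u"
proof -
  have "P (\<Sum>i\<in>A. Poly_Mapping.single i (Poly_Mapping.lookup u i))" if "finite A" for A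
    using that by induction (auto intro: assms)
  from this[of "Poly_Mapping.keys u"] show ?thesis
    by (simp flip: poly_mapping_sum_single)
qed

lemma lin_ext_superset:
  assumes "finite A" "Poly_Mapping.keys u \<subseteq> A"
  shows "lin_ext B u = (\<Sum>i\<in>A. smul (Poly_Mapping.lookup u i) (B i))"
  unfolding lin_ext_def
  by (rule sum.mono_neutral_left) (use assms in \<open>auto simp: in_keys_iff\<close>)

lemma lin_ext_add: "lin_ext B (u + v) = lin_ext B u + lin_ext B v"
proof -
  let ?A = "Poly_Mapping.keys u \<union> Poly_Mapping.keys v"
  have "Poly_Mapping.keys (u + v) \<subseteq> ?A" by (rule keys_add)
  then show ?thesis
    by (simp add: lin_ext_superset[of ?A] lookup_add smul_add_left sum.distrib)
qed

lemma lin_ext_0 [simp]: "lin_ext B 0 = 0"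
  by (simp add: lin_ext_def)

lemma lin_ext_single [simp]: "lin_ext B (Poly_Mapping.single i a) = smul a (B i)"
  by (simp add: lin_ext_def)

lemma lin_ext_smul: "lin_ext B (smul a u) = smul a (lin_ext B u)"
proof (induction u rule: poly_mapping_single_induct)
  case (single i k)
  have "smul a (Poly_Mapping.single i k) = Poly_Mapping.single i (a * k)"
    by (simp add: smul_def map_single)
  then show ?case by (simp add: smul_smul)
qed (simp_all add: smul_add_right lin_ext_add)

lemma lin_ext_add_basis: "lin_ext (\<lambda>i. B i + C i) u = lin_ext B u + lin_ext C u"
  by (induction u rule: poly_mapping_single_induct)
    (simp_all add: smul_add_right lin_ext_add)


section \<open>Characters and powers of the inverse of \<open>\<sigma>\<close>\<close>

lemma characters_add:
  fixes \<chi> :: "'g::ab_group_add \<Rightarrow> 'k::field"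
  assumes "\<chi> \<in> carrier characters"
  shows "\<chi> (g + h) = \<chi> g * \<chi> h"
  using assms by (auto simp: characters_def hom_def group_of_type_def ring_of_type_algebra_def)

lemma characters_nonzero:
  fixes \<chi> :: "'g::ab_group_add \<Rightarrow> 'k::field"
  assumes "\<chi> \<in> carrier characters"
  shows "\<chi> g \<noteq> 0"
  using assms by (auto simp: characters_def hom_def group_of_type_def ring_of_type_algebra_def)

lemma char_ext_superset:
  assumes "finite A" "Poly_Mapping.keys u \<subseteq> A"
  shows "char_ext \<rho> u = (\<Sum>g\<in>A. Poly_Mapping.lookup u g * \<rho> g)"
  unfolding char_ext_def
  by (rule sum.mono_neutral_left) (use assms in \<open>auto simp: in_keys_iff\<close>)

lemma char_ext_add: "char_ext \<rho> (u + v) = char_ext \<rho> u + char_ext \<rho> v"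
proof -
  let ?A = "Poly_Mapping.keys u \<union> Poly_Mapping.keys v"
  have "Poly_Mapping.keys (u + v) \<subseteq> ?A" by (rule keys_add)
  then show ?thesis
    by (simp add: char_ext_superset[of ?A] lookup_add sum.distrib distrib_right)
qed

lemma char_ext_diff: "char_ext \<rho> (u - v) = char_ext \<rho> u - char_ext \<rho> v"
  using char_ext_add[of \<rho> "u - v" v] by simp

lemma char_ext_single [simp]: "char_ext \<rho> (Poly_Mapping.single g a) = a * \<rho> g"
  by (simp add: char_ext_def)

lemma lookup_sigma:
  "Poly_Mapping.lookup (sigma \<chi> u) g = \<chi> g * Poly_Mapping.lookup u g"
  by (simp add: sigma_def lookup_mapp when_def in_keys_iff)

text \<open>
  The definitions use \<open>\<sigma>\<^sup>-\<^sup>1\<close> as an abstract inverse; since \<open>\<sigma>\<close> is diagonal on the basis of group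
  elements, the inverse is the diagonal map with the inverse entries, which makes every power
  of it computable coefficientwise.
\<close>

lemma inv_sigma:
  assumes "\<And>g. \<chi> g \<noteq> 0"
  shows "inv_into UNIV (sigma \<chi>) = sigma (\<lambda>g. inverse (\<chi> g))"
proof (rule inv_equality)
  show "sigma (\<lambda>g. inverse (\<chi> g)) (sigma \<chi> u) = u" for u
    by (rule poly_mapping_eqI) (simp add: lookup_sigma assms)
  show "sigma \<chi> (sigma (\<lambda>g. inverse (\<chi> g)) u) = u" for u
    by (rule poly_mapping_eqI) (simp add: lookup_sigma assms)
qed

lemma lookup_inv_sigma_power:
  assumes "\<And>g. \<chi> g \<noteq> 0"
  shows "Poly_Mapping.lookup ((inv_into UNIV (sigma \<chi>) ^^ i) u) g
    = inverse (\<chi> g) ^ i * Poly_Mapping.lookup u g"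
  by (induction i) (simp_all add: inv_sigma[OF assms] lookup_sigma)

lemma inv_sigma_power_single:
  assumes "\<And>g. \<chi> g \<noteq> 0"
  shows "(inv_into UNIV (sigma \<chi>) ^^ i) (Poly_Mapping.single g a)
    = Poly_Mapping.single g (inverse (\<chi> g) ^ i * a)"
  by (rule poly_mapping_eqI) (auto simp: lookup_inv_sigma_power[OF assms] lookup_single when_def)

lemma inv_sigma_power_diff:
  assumes "\<And>g. \<chi> g \<noteq> 0"
  shows "(inv_into UNIV (sigma \<chi>) ^^ i) (u - v)
    = (inv_into UNIV (sigma \<chi>) ^^ i) u - (inv_into UNIV (sigma \<chi>) ^^ i) v"
  by (rule poly_mapping_eqI)
    (simp add: lookup_inv_sigma_power[OF assms] lookup_minus algebra_simps)


section \<open>The action of the free algebra on \<open>V(\<rho>)\<close>\<close>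

lemma free_act_add: "free_act \<chi> b c \<rho> (f + f') u = free_act \<chi> b c \<rho> f u + free_act \<chi> b c \<rho> f' u"
  by (simp add: free_act_def lin_ext_add)

lemma free_act_0 [simp]: "free_act \<chi> b c \<rho> 0 u = 0"
  by (simp add: free_act_def)

lemma free_act_diff: "free_act \<chi> b c \<rho> (f - f') u = free_act \<chi> b c \<rho> f u - free_act \<chi> b c \<rho> f' u"
  using free_act_add[of \<chi> b c \<rho> "f - f'" f' u] by (simp add: algebra_simps)

lemma gen_act_add: "gen_act \<chi> b c \<rho> a (u + v) = gen_act \<chi> b c \<rho> a u + gen_act \<chi> b c \<rho> a v"
  by (simp add: gen_act_def lin_ext_add)

lemma gen_act_smul: "gen_act \<chi> b c \<rho> a (smul k u) = smul k (gen_act \<chi> b c \<rho> a u)"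
  by (simp add: gen_act_def lin_ext_smul)

lemma word_act_add:
  "foldr (gen_act \<chi> b c \<rho>) l (u + v) = foldr (gen_act \<chi> b c \<rho>) l u + foldr (gen_act \<chi> b c \<rho>) l v"
  by (induction l) (simp_all add: gen_act_add)

lemma word_act_smul:
  "foldr (gen_act \<chi> b c \<rho>) l (smul k u) = smul k (foldr (gen_act \<chi> b c \<rho>) l u)"
  by (induction l) (simp_all add: gen_act_smul)

lemma free_act_add_right:
  "free_act \<chi> b c \<rho> f (u + v) = free_act \<chi> b c \<rho> f u + free_act \<chi> b c \<rho> f v"
  by (simp add: free_act_def word_act_add lin_ext_add_basis)

lemma free_act_0_right [simp]: "free_act \<chi> b c \<rho> f 0 = 0"
  using free_act_add_right[of \<chi> b c \<rho> f 0 0]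
  by (simp only: add_0_left add_cancel_right_right)

text \<open>
  Concatenating words composes their actions, so linear extension turns the convolution product
  into composition.
\<close>

lemma free_act_mult:
  "free_act \<chi> b c \<rho> (f * f') u = free_act \<chi> b c \<rho> f (free_act \<chi> b c \<rho> f' u)"
proof (induction f rule: poly_mapping_single_induct)
  case (single v k)
  show ?case
  proof (induction f' rule: poly_mapping_single_induct)
    case (single w k')
    show ?case
      by (simp add: free_act_def mult_single plus_free_monoid_def word_act_smul smul_smul)
  qed (simp_all add: free_act_add free_act_add_right distrib_left)
qed (simp_all add: free_act_add distrib_right)

lemma free_act_gen [simp]: "free_act \<chi> b c \<rho> (gen_elt a) u = gen_act \<chi> b c \<rho> a u"
  by (simp add: free_act_def gen_elt_def)

lemma free_act_scal [simp]: "free_act \<chi> b c \<rho> (scal k) u = smul k u"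
  by (simp add: free_act_def scal_def zero_free_monoid_def)

lemma free_act_1 [simp]: "free_act \<chi> b c \<rho> 1 u = u"
  using free_act_scal[of \<chi> b c \<rho> 1 u] by (simp add: scal_def)

text \<open>
  Invariance of a subspace has to be checked on generators only.
\<close>

lemma free_act_closed:
  assumes "0 \<in> S" and add: "\<And>u v. u \<in> S \<Longrightarrow> v \<in> S \<Longrightarrow> u + v \<in> S"
    and smul: "\<And>k u. u \<in> S \<Longrightarrow> smul k u \<in> S"
    and gen: "\<And>a u. u \<in> S \<Longrightarrow> gen_act \<chi> b c \<rho> a u \<in> S"
    and "u \<in> S"
  shows "free_act \<chi> b c \<rho> f u \<in> S"
proof (induction f rule: poly_mapping_single_induct)
  case (single w k)
  have "foldr (gen_act \<chi> b c \<rho>) l u \<in> S" for l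
    by (induction l) (use gen \<open>u \<in> S\<close> in auto)
  then show ?case by (simp add: free_act_def smul)
qed (use assms in \<open>auto simp: free_act_add\<close>)

lemma lookup_gen_act_X:
  "Poly_Mapping.lookup (gen_act \<chi> b c \<rho> GenX u) i
    = (case i of 0 \<Rightarrow> 0 | Suc j \<Rightarrow> Poly_Mapping.lookup u j)"
  unfolding gen_act_def
  by (induction u rule: poly_mapping_single_induct)
    (auto simp: lin_ext_add lookup_add vb_def lookup_single when_def split: nat.splits)

lemma lookup_gen_act_Y:
  "Poly_Mapping.lookup (gen_act \<chi> b c \<rho> GenY u) i
    = char_ext \<rho> (sigma_bracket \<chi> (e_elt b c) (Suc i)) * Poly_Mapping.lookup u (Suc i)"
  unfolding gen_act_def
proof (induction u rule: poly_mapping_single_induct)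
  case (single j a)
  then show ?case
    by (cases j) (auto simp: vb_def lookup_single when_def)
qed (auto simp: lin_ext_add lookup_add distrib_left)

locale character_pair =
  fixes \<chi> \<rho> :: "'g::ab_group_add \<Rightarrow> 'k::field" and b c :: 'g
  assumes \<chi>_char: "\<chi> \<in> carrier characters" and \<rho>_char: "\<rho> \<in> carrier characters"
begin

abbreviation gact where "gact \<equiv> gen_act \<chi> b c \<rho>"
abbreviation act where "act \<equiv> free_act \<chi> b c \<rho>"
abbreviation H where "H \<equiv> H_alg \<chi> b c"
abbreviation V where "V \<equiv> V_mod \<chi> b c \<rho>"

text \<open>The scalar with \<open>y \<cdot> v\<^sub>i = \<beta>\<^sub>i v\<^sub>i\<^sub>-\<^sub>1\<close>.\<close>

definition \<beta> :: "nat \<Rightarrow> 'k" where "\<beta> i = char_ext \<rho> (sigma_bracket \<chi> (e_elt b c) i)"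

lemmas \<chi>_add = characters_add[OF \<chi>_char] and \<rho>_add = characters_add[OF \<rho>_char]
lemmas \<chi>_nz [simp] = characters_nonzero[OF \<chi>_char]
lemmas \<rho>_nz [simp] = characters_nonzero[OF \<rho>_char]

lemma \<chi>_0 [simp]: "\<chi> 0 = 1"
  using \<chi>_add[of 0 0] by simp

lemma \<rho>_0 [simp]: "\<rho> 0 = 1"
  using \<rho>_add[of 0 0] by simp

lemma \<beta>_0 [simp]: "\<beta> 0 = 0"
  by (simp add: \<beta>_def sigma_bracket_def char_ext_def)

text \<open>
  The increment is \<open>\<rho>(\<sigma>\<^sup>-\<^sup>i(e))\<close>, the scalar by which \<open>e\<close> acts on \<open>v\<^sub>i\<close>; this is the relation
  \<open>yx = xy + e\<close> evaluated at \<open>v\<^sub>i\<close>.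
\<close>

lemma \<beta>_Suc:
  "\<beta> (Suc i) = \<beta> i + (inverse (\<chi> (- c)) ^ i * \<rho> (- c) - inverse (\<chi> b) ^ i * \<rho> b)"
  by (simp add: \<beta>_def sigma_bracket_def e_elt_def char_ext_add char_ext_diff
      inv_sigma_power_diff inv_sigma_power_single)

lemmas lookup_X [simp] = lookup_gen_act_X[of \<chi> b c \<rho>]
lemmas lookup_Y [simp] = lookup_gen_act_Y[of \<chi> b c \<rho>, folded \<beta>_def]

lemma lookup_gr [simp]:
  "Poly_Mapping.lookup (gact (Gr g) u) i = inverse (\<chi> g) ^ i * \<rho> g * Poly_Mapping.lookup u i"
  unfolding gen_act_def
  by (induction u rule: poly_mapping_single_induct)
    (auto simp: lin_ext_add lookup_add vb_def lookup_single when_def algebra_simps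
      inv_sigma_power_single)

text \<open>
  The generators act on coordinates by explicit shifts and scalings, so each relation becomes an
  identity between coordinates: multiplicativity of \<open>\<chi>\<close> and \<open>\<rho>\<close> for the relations with group
  elements, and the recursion for \<open>\<beta>\<close> for the last one.
\<close>

lemma act_relators:
  assumes "f \<in> relators \<chi> b c"
  shows "act f u = 0"
proof -
  have "act (gr 0 - 1) u = 0"
    by (rule poly_mapping_eqI) (simp add: free_act_diff lookup_minus)
  moreover have "act (gr g * gr h - gr (g + h)) u = 0" for g h
    by (rule poly_mapping_eqI)
      (simp add: free_act_diff free_act_mult lookup_minus \<chi>_add \<rho>_add power_mult_distrib)
  moreover have "act (xx * gr g - scal (\<chi> g) * gr g * xx) u = 0" for g
    by (rule poly_mapping_eqI)
      (simp add: free_act_diff free_act_mult lookup_minus field_simps split: nat.splits)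
  moreover have "act (yy * gr g - scal (inverse (\<chi> g)) * gr g * yy) u = 0" for g
    by (rule poly_mapping_eqI)
      (simp add: free_act_diff free_act_mult lookup_minus field_simps)
  moreover have "act (yy * xx - (xx * yy + (gr (- c) - gr b))) u = 0"
    by (rule poly_mapping_eqI)
      (simp add: free_act_diff free_act_add free_act_mult lookup_minus lookup_add \<beta>_Suc
        algebra_simps split: nat.splits)
  ultimately show ?thesis
    using assms unfolding relators_def by blast
qed

end


section \<open>\<open>V(\<rho>)\<close> as a module over \<open>H\<close>\<close>

lemma ring_of_type_algebra_ring: "ring (ring_of_type_algebra :: 'a::ring_1 ring)"
proof -
  have "\<exists>y. y + x = 0" for x :: 'a
    by (rule exI[of _ "- x"]) simp
  then show ?thesis
    by (intro ringI abelian_groupI monoidI)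
      (auto simp: ring_of_type_algebra_def algebra_simps)
qed

context character_pair
begin

lemma free_ring: "ring (free_ring :: ('g, 'k) free_alg ring)"
  unfolding free_ring_def by (rule ring_of_type_algebra_ring)

lemma rel_ideal_ideal: "ideal (rel_ideal \<chi> b c) free_ring"
  unfolding rel_ideal_def
  by (rule ring.genideal_ideal[OF free_ring]) (simp add: free_ring_def ring_of_type_algebra_def)

text \<open>
  The elements acting as zero form a two-sided ideal; it contains the relators, hence the ideal
  that they generate.
\<close>

lemma act_rel_ideal:
  assumes "f \<in> rel_ideal \<chi> b c"
  shows "act f u = 0"
proof -
  let ?A = "{f. \<forall>u. act f u = 0}"
  have add_inv: "\<ominus>\<^bsub>free_ring\<^esub> f = - f" for f :: "('g, 'k) free_alg"
    by (rule abelian_group.minus_equality[OF ring.is_abelian_group[OF free_ring]])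
      (auto simp: free_ring_def ring_of_type_algebra_def)
  have "ideal ?A free_ring"
  proof (rule idealI[OF free_ring])
    show "subgroup ?A (add_monoid free_ring)"
    proof
      show "inv\<^bsub>add_monoid free_ring\<^esub> f \<in> ?A" if "f \<in> ?A" for f
      proof -
        have "inv\<^bsub>add_monoid free_ring\<^esub> f = - f"
          using add_inv by (simp only: a_inv_def)
        then show ?thesis
          using that free_act_diff[of \<chi> b c \<rho> 0 f] by simp
      qed
    qed (auto simp: free_ring_def ring_of_type_algebra_def free_act_add)
  qed (auto simp: free_ring_def ring_of_type_algebra_def free_act_mult)
  then have "rel_ideal \<chi> b c \<subseteq> ?A"
    unfolding rel_ideal_def using act_relators
    by (intro ring.genideal_minimal[OF free_ring]) auto
  then show ?thesis using assms by auto
qed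

abbreviation cls where "cls \<equiv> H_class \<chi> b c"

lemma H_carrier: "carrier H = range cls"
  by (auto simp: H_alg_def FactRing_def A_RCOSETS_def' H_class_def free_ring_def
      ring_of_type_algebra_def)

lemma H_ring: "ring H"
  unfolding H_alg_def by (rule ideal.quotient_is_ring[OF rel_ideal_ideal])

lemma H_class_hom: "cls \<in> ring_hom free_ring H"
  using ideal.rcos_ring_hom[OF rel_ideal_ideal]
  by (simp add: H_alg_def H_class_def[abs_def])

lemma H_class_simps:
  "cls f \<oplus>\<^bsub>H\<^esub> cls f' = cls (f + f')" "cls f \<otimes>\<^bsub>H\<^esub> cls f' = cls (f * f')" "\<one>\<^bsub>H\<^esub> = cls 1"
  using ring_hom_add[OF H_class_hom, of f f'] ring_hom_mult[OF H_class_hom, of f f']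
    ring_hom_one[OF H_class_hom]
  by (simp_all add: free_ring_def ring_of_type_algebra_def)

lemma V_simps [simp]:
  "carrier V = UNIV" "\<zero>\<^bsub>V\<^esub> = 0" "u \<oplus>\<^bsub>V\<^esub> v = u + v"
  by (simp_all add: V_mod_def)

text \<open>
  By the previous lemma all representatives of a class act alike, so the set of their values is
  a singleton.
\<close>

lemma V_smult [simp]: "cls f \<odot>\<^bsub>V\<^esub> u = act f u"
proof -
  interpret ideal "rel_ideal \<chi> b c" free_ring by (rule rel_ideal_ideal)
  have same: "act h u = act f u" if "h \<in> cls f" for h
  proof -
    from that obtain r where "r \<in> rel_ideal \<chi> b c" "h = r + f"
      by (auto simp: H_class_def a_r_coset_def' free_ring_def ring_of_type_algebra_def)
    then show ?thesis by (simp add: free_act_add act_rel_ideal)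
  qed
  have "f \<in> cls f"
    unfolding H_class_def by (rule a_rcos_self) (simp add: free_ring_def ring_of_type_algebra_def)
  have "(\<lambda>h. act h u) ` cls f = (\<lambda>_. act f u) ` cls f"
    by (rule image_cong[OF refl same])
  also have "\<dots> = {act f u}"
    by (rule image_constant[OF \<open>f \<in> cls f\<close>])
  finally have "(\<lambda>h. act h u) ` cls f = {act f u}" .
  then show ?thesis by (simp add: V_mod_def)
qed

sublocale V: left_module H V
proof (intro left_module.intro left_module_axioms.intro H_ring)
  show "abelian_group V"
  proof (rule abelian_groupI)
    show "\<exists>v\<in>carrier V. v \<oplus>\<^bsub>V\<^esub> u = \<zero>\<^bsub>V\<^esub>" for u
      by (auto intro: exI[of _ "- u"])
  qed (simp_all add: add.assoc add.commute)
  fix a a' u v assume "a \<in> carrier H" "a' \<in> carrier H"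
  then obtain f f' where "a = cls f" "a' = cls f'" by (auto simp: H_carrier)
  then show "(a \<oplus>\<^bsub>H\<^esub> a') \<odot>\<^bsub>V\<^esub> u = a \<odot>\<^bsub>V\<^esub> u \<oplus>\<^bsub>V\<^esub> a' \<odot>\<^bsub>V\<^esub> u"
    and "(a \<otimes>\<^bsub>H\<^esub> a') \<odot>\<^bsub>V\<^esub> u = a \<odot>\<^bsub>V\<^esub> (a' \<odot>\<^bsub>V\<^esub> u)"
    by (simp_all add: H_class_simps free_act_add free_act_mult)
next
  fix a u v assume "a \<in> carrier H"
  then obtain f where "a = cls f" by (auto simp: H_carrier)
  then show "a \<odot>\<^bsub>V\<^esub> (u \<oplus>\<^bsub>V\<^esub> v) = a \<odot>\<^bsub>V\<^esub> u \<oplus>\<^bsub>V\<^esub> a \<odot>\<^bsub>V\<^esub> v"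
    by (simp add: free_act_add_right)
next
  show "\<one>\<^bsub>H\<^esub> \<odot>\<^bsub>V\<^esub> u = u" for u
    by (simp add: H_class_simps)
qed simp

lemma submodule_closed:
  assumes "submodule S H V"
  shows "0 \<in> S" and "u \<in> S \<Longrightarrow> v \<in> S \<Longrightarrow> u + v \<in> S"
    and "u \<in> S \<Longrightarrow> act f u \<in> S"
    and "u \<in> S \<Longrightarrow> smul k u \<in> S"
    and "u \<in> S \<Longrightarrow> gact a u \<in> S"
proof -
  interpret abelian_subgroup S V by (rule V.submodule_abelian_subgroup[OF assms])
  show "0 \<in> S" using zero_closed by simp
  show "u \<in> S \<Longrightarrow> v \<in> S \<Longrightarrow> u + v \<in> S" using a_closed by simp
  have act: "u \<in> S \<Longrightarrow> act f u \<in> S" for f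
    using submodule.smult_closed[OF assms, of "cls f" u] by (simp add: H_carrier)
  then show "u \<in> S \<Longrightarrow> act f u \<in> S" .
  show "u \<in> S \<Longrightarrow> smul k u \<in> S" using act[of "scal k"] by simp
  show "u \<in> S \<Longrightarrow> gact a u \<in> S" using act[of "gen_elt a"] by simp
qed

section \<open>The submodule spanned by \<open>v\<^sub>d, v\<^sub>d\<^sub>+\<^sub>1, \<dots>\<close>\<close>

text \<open>
  The span of the \<open>v\<^sub>i\<close> with \<open>i \<ge> m\<close>, described by coordinates so that membership after applying
  a generator is a computation.
\<close>

definition tail :: "nat \<Rightarrow> (nat \<Rightarrow>\<^sub>0 'k) set" where
  "tail m = {u. \<forall>i<m. Poly_Mapping.lookup u i = 0}"

text \<open>Applying \<open>x\<close> to \<open>v\<^sub>m\<close> produces every later basis vector.\<close>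

lemma tail_subset_submodule:
  assumes S: "submodule S H V" and "vb m \<in> S"
  shows "tail m \<subseteq> S"
proof
  fix u assume u: "u \<in> tail m"
  have basis: "vb (m + i) \<in> S" for i
  proof (induction i)
    case (Suc i)
    have "gact GenX (vb (m + i)) = vb (m + Suc i)"
      by (simp add: gen_act_def vb_def)
    then show ?case using submodule_closed(5)[OF S Suc, of GenX] by simp
  qed (use assms in simp)
  have "(\<Sum>i\<in>A. Poly_Mapping.single i (Poly_Mapping.lookup u i)) \<in> S" if "finite A" for A
    using that
  proof induction
    case (insert i A)
    have "Poly_Mapping.single i (Poly_Mapping.lookup u i) \<in> S"
    proof (cases "m \<le> i")
      case True
      then have "vb i \<in> S" using basis[of "i - m"] by simp
      moreover have "Poly_Mapping.single i (Poly_Mapping.lookup u i)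
          = smul (Poly_Mapping.lookup u i) (vb i)"
        by (rule poly_mapping_eqI) (simp add: vb_def lookup_single when_def)
      ultimately show ?thesis using submodule_closed(4)[OF S] by simp
    next
      case False
      then show ?thesis using u submodule_closed(1)[OF S] by (simp add: tail_def)
    qed
    then show ?case using insert submodule_closed(2)[OF S] by simp
  qed (use submodule_closed(1)[OF S] in simp)
  from this[of "Poly_Mapping.keys u"] show "u \<in> S"
    by (simp flip: poly_mapping_sum_single)
qed

text \<open>
  Group elements and \<open>x\<close> never lower the index. The only way out of the span is \<open>y\<close> applied to
  \<open>v\<^sub>d\<close>, and \<open>y \<cdot> v\<^sub>d = \<beta>\<^sub>d v\<^sub>d\<^sub>-\<^sub>1 = 0\<close>.
\<close>

lemma tail_submodule:
  assumes "\<beta> d = 0"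
  shows "submodule (tail d) H V"
proof (rule V.submoduleI)
  have Y: "gact GenY u \<in> tail d" if "u \<in> tail d" for u
  proof -
    have "\<beta> (Suc i) * Poly_Mapping.lookup u (Suc i) = 0" if "i < d" for i
      using that \<open>u \<in> tail d\<close> assms by (cases "Suc i = d") (auto simp: tail_def)
    then show ?thesis by (simp add: tail_def)
  qed
  have gen: "gact a u \<in> tail d" if "u \<in> tail d" for a u
    by (cases a) (use that Y in \<open>auto simp: tail_def split: nat.splits\<close>)
  show "a \<odot>\<^bsub>V\<^esub> u \<in> tail d" if a: "a \<in> carrier H" and u: "u \<in> tail d" for a u
  proof -
    from a obtain f where "a = cls f" by (auto simp: H_carrier)
    moreover have "act f u \<in> tail d"
      by (rule free_act_closed[OF _ _ _ gen u]) (auto simp: tail_def lookup_add)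
    ultimately show ?thesis by simp
  qed
qed (auto simp: tail_def lookup_add)

lemma cyclic_submodule_eq_tail:
  assumes "\<beta> d = 0"
  shows "cyclic_submodule H V (vb d) = tail d"
proof
  note T = tail_submodule[OF assms]
  have cyclic: "cyclic_submodule H V (vb d) = range (\<lambda>f. act f (vb d))"
  proof -
    have "cyclic_submodule H V (vb d) = range (\<lambda>f. cls f \<odot>\<^bsub>V\<^esub> vb d)"
      unfolding cyclic_submodule_def H_carrier by blast
    then show ?thesis by simp
  qed
  have "vb d \<in> tail d" by (auto simp: tail_def vb_def lookup_single)
  then show "cyclic_submodule H V (vb d) \<subseteq> tail d"
    using submodule_closed(3)[OF T] by (auto simp: cyclic)
  have "submodule (cyclic_submodule H V (vb d)) H V"
  proof (rule V.submoduleI)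
    show "\<zero>\<^bsub>V\<^esub> \<in> cyclic_submodule H V (vb d)"
      using free_act_0[of \<chi> b c \<rho> "vb d"] unfolding cyclic by (metis V_simps(2) rangeI)
    show "u \<oplus>\<^bsub>V\<^esub> v \<in> cyclic_submodule H V (vb d)"
      if "u \<in> cyclic_submodule H V (vb d)" "v \<in> cyclic_submodule H V (vb d)" for u v
      using that unfolding cyclic by (auto simp flip: free_act_add)
    show "a \<odot>\<^bsub>V\<^esub> u \<in> cyclic_submodule H V (vb d)"
      if "a \<in> carrier H" "u \<in> cyclic_submodule H V (vb d)" for a u
      using that unfolding cyclic by (auto simp: H_carrier simp flip: free_act_mult)
  qed simp
  moreover have "vb d \<in> cyclic_submodule H V (vb d)"
    using free_act_1[of \<chi> b c \<rho> "vb d"] unfolding cyclic by (metis rangeI)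
  ultimately show "tail d \<subseteq> cyclic_submodule H V (vb d)"
    by (rule tail_subset_submodule)
qed

lemma x_power_in_tail: "(gact GenX ^^ k) u \<in> tail k"
proof (induction k)
  case (Suc k)
  then show ?case by (auto simp: tail_def split: nat.splits)
qed (simp add: tail_def)

text \<open>
  Each application of \<open>y\<close> lowers by one the bound \<open>m\<close> on the indices below \<open>d\<close> that occur in \<open>u\<close>.
  Nothing re-enters that range from above, again because \<open>\<beta>\<^sub>d = 0\<close>.
\<close>

lemma y_power_in_tail:
  assumes "\<beta> d = 0" and "\<And>i. \<lbrakk>m \<le> i; i < d\<rbrakk> \<Longrightarrow> Poly_Mapping.lookup u i = 0"
  shows "(gact GenY ^^ m) u \<in> tail d"
  using assms(2)
proof (induction m arbitrary: u)
  case (Suc m)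
  have "Poly_Mapping.lookup (gact GenY u) i = 0" if "m \<le> i" "i < d" for i
    using Suc.prems[of "Suc i"] that assms(1) by (cases "Suc i = d") auto
  then show ?case using Suc.IH[of "gact GenY u"] by (simp add: funpow_swap1)
qed (simp add: tail_def)

text \<open>
  This is where minimality of \<open>d\<close> enters. Modulo the span of \<open>v\<^sub>d, v\<^sub>d\<^sub>+\<^sub>1, \<dots>\<close>, the vector \<open>u\<close> has
  leading term \<open>v\<^sub>m\<close> with \<open>m < d\<close>. The power \<open>y\<^sup>m\<close> multiplies the leading coefficient by
  \<open>\<beta>\<^sub>m \<beta>\<^sub>m\<^sub>-\<^sub>1 \<cdots> \<beta>\<^sub>1 \<noteq> 0\<close> and kills all lower terms, leaving a nonzero multiple of \<open>v\<^sub>0\<close>.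
\<close>

lemma submodule_contains_lowest:
  assumes "\<beta> d = 0" and "\<And>j. \<lbrakk>0 < j; j < d\<rbrakk> \<Longrightarrow> \<beta> j \<noteq> 0"
    and S: "submodule S H V" and "tail d \<subseteq> S"
    and "u \<in> S" and "m < d" and "Poly_Mapping.lookup u m \<noteq> 0"
    and "\<And>i. \<lbrakk>m < i; i < d\<rbrakk> \<Longrightarrow> Poly_Mapping.lookup u i = 0"
  shows "vb 0 \<in> S"
  using assms(5-)
proof (induction m arbitrary: u)
  case 0
  let ?k = "Poly_Mapping.lookup u 0"
  have "vb 0 - smul (inverse ?k) u \<in> tail d"
    using 0 by (auto simp: tail_def vb_def lookup_minus lookup_one when_def)
  then have "vb 0 - smul (inverse ?k) u + smul (inverse ?k) u \<in> S"
    using \<open>tail d \<subseteq> S\<close> 0 submodule_closed(2,4)[OF S] by blast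
  then show ?case by simp
next
  case (Suc m)
  show ?case
  proof (rule Suc.IH)
    show "gact GenY u \<in> S" using Suc.prems submodule_closed(5)[OF S] by simp
    show "m < d" using Suc.prems by simp
    show "Poly_Mapping.lookup (gact GenY u) m \<noteq> 0"
      using Suc.prems assms(2)[of "Suc m"] by simp
    show "Poly_Mapping.lookup (gact GenY u) i = 0" if "m < i" "i < d" for i
      using Suc.prems(4)[of "Suc i"] that assms(1) by (cases "Suc i = d") auto
  qed
qed

text \<open>
  A submodule strictly above the span contains a vector with a leading term of index below \<open>d\<close>,
  hence \<open>v\<^sub>0\<close>, and \<open>x\<close> generates everything from \<open>v\<^sub>0\<close>.
\<close>

lemma tail_maximal:
  assumes "\<beta> d = 0" and "\<And>j. \<lbrakk>0 < j; j < d\<rbrakk> \<Longrightarrow> \<beta> j \<noteq> 0"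
    and S: "submodule S H V" and "tail d \<subseteq> S"
  shows "S = tail d \<or> S = UNIV"
proof (rule disjCI)
  assume "S \<noteq> UNIV"
  have "u \<in> tail d" if "u \<in> S" for u
  proof (rule ccontr)
    assume "u \<notin> tail d"
    define A where "A = {i. i < d \<and> Poly_Mapping.lookup u i \<noteq> 0}"
    have A: "finite A" "A \<noteq> {}" using \<open>u \<notin> tail d\<close> by (auto simp: A_def tail_def)
    have "vb 0 \<in> S"
    proof (rule submodule_contains_lowest[OF assms that])
      show "Max A < d" "Poly_Mapping.lookup u (Max A) \<noteq> 0"
        using Max_in[OF A] by (auto simp: A_def)
      show "Poly_Mapping.lookup u i = 0" if "Max A < i" "i < d" for i
      proof -
        have "i \<notin> A" using that Max_ge[OF A(1), of i] by auto
        then show ?thesis using \<open>i < d\<close> by (simp add: A_def)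
      qed
    qed
    then have "S = UNIV" using tail_subset_submodule[OF S, of 0] by (auto simp: tail_def)
    with \<open>S \<noteq> UNIV\<close> show False by simp
  qed
  then show "S = tail d" using \<open>tail d \<subseteq> S\<close> by auto
qed

end

section \<open>The quotient \<open>V(\<rho>) / H v\<^sub>d\<close>\<close>

theorem proposition5p8:
  fixes \<chi> \<rho> :: "'g::ab_group_add \<Rightarrow> 'k::{alg_closed_field, field_char_0}"
    and b c :: 'g and n d :: nat
  assumes "finitely_generated (group_of_type :: 'g monoid)"
    and "\<chi> \<in> carrier characters"
    and "n > 0" and "group.ord characters \<chi> = n"
    and "\<chi> b = \<chi> c" and "b + c \<noteq> 0"
    and "\<rho> \<in> carrier characters"
    and "d > 0" and "char_ext \<rho> (sigma_bracket \<chi> (e_elt b c) d) = 0"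
    and "\<And>j. \<lbrakk>0 < j; j < d\<rbrakk> \<Longrightarrow> char_ext \<rho> (sigma_bracket \<chi> (e_elt b c) j) \<noteq> 0"
  shows "torsion_module (H_alg \<chi> b c) (H_class \<chi> b c xx) (V_bar \<chi> b c \<rho> d)
    \<and> torsion_module (H_alg \<chi> b c) (H_class \<chi> b c yy) (V_bar \<chi> b c \<rho> d)
    \<and> simple_module (H_alg \<chi> b c) (V_bar \<chi> b c \<rho> d)"
proof -
  interpret character_pair \<chi> \<rho> b c by standard fact+
  have \<beta>_d: "\<beta> d = 0" using assms(9) by (simp add: \<beta>_def)
  have \<beta>_less: "\<beta> j \<noteq> 0" if "0 < j" "j < d" for j
    using assms(10)[OF that] by (simp add: \<beta>_def)
  note T = tail_submodule[OF \<beta>_d]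
  have V_bar: "V_bar \<chi> b c \<rho> d = quotient_module V (tail d)"
    by (simp add: V_bar_def cyclic_submodule_eq_tail[OF \<beta>_d])
  have "torsion_module H (cls xx) (quotient_module V (tail d))"
    using x_power_in_tail[of d] \<open>d > 0\<close>
    by (intro V.quotient_torsion[OF T] exI[of _ d]) (simp_all add: H_carrier)
  moreover have "torsion_module H (cls yy) (quotient_module V (tail d))"
    using y_power_in_tail[OF \<beta>_d, of d] \<open>d > 0\<close>
    by (intro V.quotient_torsion[OF T] exI[of _ d]) (simp_all add: H_carrier)
  moreover have "simple_module H (quotient_module V (tail d))"
  proof (rule V.quotient_simple[OF T])
    have "vb 0 \<notin> tail d" using \<open>d > 0\<close> by (auto simp: tail_def vb_def)
    then show "tail d \<noteq> carrier V" by auto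
    show "L = tail d \<or> L = carrier V" if "submodule L H V" "tail d \<subseteq> L" for L
      using tail_maximal[OF \<beta>_d \<beta>_less that] by simp
  qed
  ultimately show ?thesis unfolding V_bar by simp
qed

end
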